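(* Let $G$ be a connected simple undirected graph on the node set $\{0,1,\dots,n\}$ with $n\ge 1$, and let $\nabla_G\subset\mathbb{R}^n$ be its adjacency polytope. Then for every facet $F$ of $\nabla_G$, the facet subnetwork $G_F=(\mathcal{V}_F,\mathcal{E}_F)$ has the following properties: (i) $G_F$ is acyclic (contains no directed cycle); (ii) $G_F$ contains all the nodes, i.e. $\mathcal{V}_F=\{0,1,\dots,n\}$; (iii) $G_F$ is weakly connected; (iv) any two directed paths in $G_F$ with the same starting node and the same end node have the same length; (v) if a directed path of $G_F$ of length $m$ consists of edges of a cycle of $G$ of length $\ell$, then $m\le \ell/2$ (each path in $G_F$ contains no more than half of the edges of any cycle in $G$ containing it); (vi) the transpose of $G_F$ (the directed graph on the same nodes with all edge directions reversed) is also a facet subnetwork of $\nabla_G$, namely $G_{-F}$, where $-F=\{-\mathbf{x}:\mathbf{x}\in F\}$ is also a facet of $\nabla_G$.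
   Context: Let $\mathbf{e}_1,\dots,\mathbf{e}_n$ be the standard basis of $\mathbb{R}^n$ and set $\mathbf{e}_0=\mathbf{0}$. Each undirected edge $\{i,j\}$ of $G$ is regarded as the two directed edges $(i,j)$ and $(j,i)$; write $\mathcal{E}(G)$ for the set of these directed edges. The adjacency polytope of $G$ is $\nabla_G=\operatorname{conv}\{\mathbf{e}_i-\mathbf{e}_j : (i,j)\in\mathcal{E}(G)\}\subset\mathbb{R}^n$ (a centrally symmetric polytope). A facet is a face of $\nabla_G$ of dimension $n-1$. For a facet $F$, define $\mathcal{V}_F=\{i : \mathbf{e}_i-\mathbf{e}_j\in F \text{ or } \mathbf{e}_j-\mathbf{e}_i\in F \text{ for some } j\}$ and $\mathcal{E}_F=\{(i,j) : \mathbf{e}_i-\mathbf{e}_j\in F\}$ (directed edges); the facet subnetwork associated with $F$ is the directed graph $G_F=(\mathcal{V}_F,\mathcal{E}_F)$. *)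

theory Defs
  imports "HOL-Analysis.Analysis" "Graph_Theory.Digraph_Component"
begin

text \<open>
  The ambient space is \<^typ>\<open>real ^ 'n\<close>, so the dimension is \<^term>\<open>n = CARD('n)\<close> (at least 1, since types
  are nonempty).  The node set \<open>{0, 1, \<dots>, n}\<close> is the type \<^typ>\<open>'n option\<close>: \<^term>\<open>None\<close> is the
  distinguished node 0, and \<^term>\<open>Some i\<close> is the node belonging to the coordinate \<open>i\<close>.

  A simple undirected graph is a \<^locale>\<open>pair_graph\<close>, that is, a finite loop-free digraph without
  parallel arcs whose arc set is symmetric.  Its \<^const>\<open>parcs\<close> is thus the set of directed
  edges \<open>(i, j)\<close>, \<open>(j, i)\<close> coming from the undirected edges \<open>{i, j}\<close>.
\<close>

definition node_vec :: "'n option \<Rightarrow> real ^ 'n::finite" where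
  "node_vec v = (case v of None \<Rightarrow> 0 | Some i \<Rightarrow> axis i 1)"

definition adjacency_polytope :: "'n option pair_pre_digraph \<Rightarrow> (real ^ 'n::finite) set" where
  "adjacency_polytope G = convex hull {node_vec i - node_vec j | i j. (i, j) \<in> parcs G}"

text \<open>
  Facets are the faces of dimension \<open>n - 1\<close>.  When the polytope is full-dimensional, this is
  the library's \<^term>\<open>F facet_of adjacency_polytope G\<close>.
\<close>

definition is_facet :: "'n option pair_pre_digraph \<Rightarrow> (real ^ 'n::finite) set \<Rightarrow> bool" where
  "is_facet G F \<longleftrightarrow> F face_of adjacency_polytope G \<and> aff_dim F = int CARD('n) - 1"

definition facet_nodes :: "(real ^ 'n::finite) set \<Rightarrow> 'n option set" where
  "facet_nodes F = {i. \<exists>j. node_vec i - node_vec j \<in> F \<or> node_vec j - node_vec i \<in> F}"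

definition facet_arcs :: "(real ^ 'n::finite) set \<Rightarrow> ('n option \<times> 'n option) set" where
  "facet_arcs F = {(i, j). node_vec i - node_vec j \<in> F}"

definition facet_subnetwork :: "(real ^ 'n::finite) set \<Rightarrow> 'n option pair_pre_digraph" where
  "facet_subnetwork F = \<lparr>pverts = facet_nodes F, parcs = facet_arcs F\<rparr>"

definition transpose_digraph :: "'a pair_pre_digraph \<Rightarrow> 'a pair_pre_digraph" where
  "transpose_digraph H = \<lparr>pverts = pverts H, parcs = (parcs H)\<inverse>\<rparr>"

text \<open>
  In a symmetric digraph the library's \<open>cycle\<close> admits \<open>u, v, u\<close>, which is not a cycle of
  the underlying simple graph; hence the bound on the length.  A cycle is given as the list of
  its arcs in one of its two orientations.
\<close>

definition undirected_cycle :: "'a pair_pre_digraph \<Rightarrow> ('a \<times> 'a) list \<Rightarrow> bool" where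
  "undirected_cycle G c \<longleftrightarrow> pre_digraph.cycle (with_proj G) c \<and> 3 \<le> length c"

end

theory Submission
  imports Defs
begin

text \<open>
  A facet \<open>F\<close> lies in a hyperplane \<open>a \<bullet> x = 1\<close> with \<open>a \<bullet> x \<le> 1\<close> on the polytope.  Reading \<open>a\<close> as a
  height \<open>h\<close> on the nodes, \<open>h\<close> drops by exactly 1 along every arc of the facet subnetwork and changes
  by at most 1 along every edge of the graph.  So the length of a directed path is the height
  difference of its end points, which excludes directed cycles; and both ways round a cycle from one
  end point of the path to the other are at least as long as the path.  Since \<open>F\<close> has dimension
  \<open>n - 1\<close> and its hyperplane misses the origin, \<open>F\<close> spans the space; the differences \<open>e\<^sub>i - e\<^sub>j\<close> over
  a set of arcs span exactly when the arcs connect all the nodes.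
\<close>

section \<open>Spanning sets of arc vectors\<close>

definition arc_vectors :: "('n option \<times> 'n option) set \<Rightarrow> (real ^ 'n::finite) set" where
  "arc_vectors A = (\<lambda>(i, j). node_vec i - node_vec j) ` A"

lemma adjacency_polytope_eq: "adjacency_polytope G = convex hull arc_vectors (parcs G)"
  unfolding adjacency_polytope_def arc_vectors_def by (rule arg_cong[where f = "(hull) convex"]) auto

text \<open>Turns a potential on the nodes into a linear functional on the space. Since node
  \<open>None\<close> sits at the origin, the potential is first shifted to vanish there;
  differences along arcs are unaffected.\<close>

lemma inner_node_vec: "(\<chi> k. g (Some k) - g None) \<bullet> node_vec v = g v - g None"
  by (cases v) (simp_all add: node_vec_def inner_axis)

text \<open>A set of vectors spans iff only 0 is orthogonal to it, and the vectors orthogonal to all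
  arc vectors are exactly the potentials constant along arcs, up to additive constants.\<close>

lemma span_arc_vectors_iff:
  fixes A :: "('n::finite option \<times> 'n option) set"
  shows "span (arc_vectors A) = UNIV \<longleftrightarrow>
    (\<forall>g :: 'n option \<Rightarrow> real. (\<forall>(i, j) \<in> A. g i = g j) \<longrightarrow> (\<forall>i j. g i = g j))"
    (is "?L \<longleftrightarrow> ?R")
proof
  assume span: ?L
  show ?R
  proof (intro allI impI)
    fix g :: "'n option \<Rightarrow> real" and i j
    assume g: "\<forall>(i, j) \<in> A. g i = g j"
    define a :: "real ^ 'n" where "a = (\<chi> k. g (Some k) - g None)"
    have "orthogonal a x" if "x \<in> arc_vectors A" for x
      using that g
      by (auto simp: arc_vectors_def a_def orthogonal_def inner_diff_right inner_node_vec)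
    then have "orthogonal a x" for x
      using span orthogonal_to_span by blast
    then have "a = 0"
      by (metis orthogonal_self)
    then show "g i = g j"
      using inner_node_vec[of g i] inner_node_vec[of g j] by (simp add: a_def)
  qed
next
  assume const: ?R
  show ?L
  proof (rule ccontr)
    assume "span (arc_vectors A) \<noteq> UNIV"
    then obtain a where a: "a \<noteq> 0" "\<And>x. x \<in> span (arc_vectors A) \<Longrightarrow> a \<bullet> x = 0"
      using span_not_UNIV_orthogonal by blast
    have "a \<bullet> node_vec i = a \<bullet> node_vec j" if "(i, j) \<in> A" for i j
    proof -
      have "node_vec i - node_vec j \<in> arc_vectors A"
        using that by (auto simp: arc_vectors_def)
      then have "a \<bullet> (node_vec i - node_vec j) = 0"
        by (intro a(2) span_base)
      then show ?thesis
        by (simp add: inner_diff_right)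
    qed
    then have "a \<bullet> node_vec (Some k) = a \<bullet> node_vec None" for k
      using const[rule_format, of "\<lambda>v. a \<bullet> node_vec v"] by blast
    \<comment> \<open>Comparing with \<open>None\<close>, whose vector is 0, makes every coordinate
      of \<open>a\<close> vanish.\<close>
    then have "a $ k = 0" for k
      by (simp add: node_vec_def inner_axis)
    then show False
      using a(1) by (simp add: vec_eq_iff)
  qed
qed

lemma connected_iff_potentials_constant:
  assumes V: "pverts H = UNIV"
  shows "Digraph_Component.connected (with_proj H) \<longleftrightarrow>
    (\<forall>g :: 'a \<Rightarrow> real. (\<forall>(i, j) \<in> parcs H. g i = g j) \<longrightarrow> (\<forall>i j. g i = g j))"
    (is "?L \<longleftrightarrow> ?R")
proof -
  let ?r = "rtrancl_on UNIV ((parcs H)\<^sup>s)"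
  have conn: "?L \<longleftrightarrow> (\<forall>u v. (u, v) \<in> ?r)"
    by (simp add: connected_conv V)
  show ?thesis
  proof
    assume ?L
    show ?R
    proof (intro allI impI)
      fix g :: "'a \<Rightarrow> real" and i j
      assume g: "\<forall>(i, j) \<in> parcs H. g i = g j"
      have "(i, j) \<in> ?r"
        using \<open>?L\<close> conn by blast
      then show "g i = g j"
        using g by induction (auto simp: symcl_def)
    qed
  next
    assume const: ?R
    have "(u, v) \<in> ?r" for u v
    proof -
      \<comment> \<open>The indicator of the component of \<open>u\<close> does not change along
        arcs, so it is constant, with value 1 at \<open>u\<close>.\<close>
      define g :: "'a \<Rightarrow> real" where "g w = of_bool ((u, w) \<in> ?r)" for w
      have "(u, i) \<in> ?r \<longleftrightarrow> (u, j) \<in> ?r" if "(i, j) \<in> parcs H" for i j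
      proof -
        have "(i, j) \<in> (parcs H)\<^sup>s" "(j, i) \<in> (parcs H)\<^sup>s"
          using that by (force simp: symcl_def)+
        then show ?thesis
          by (meson UNIV_I rtrancl_on_into_rtrancl_on)
      qed
      then have "\<forall>(i, j) \<in> parcs H. g i = g j"
        by (auto simp: g_def)
      then have "g v = g u"
        using const by blast
      then show ?thesis
        by (simp add: g_def)
    qed
    then show ?L
      using conn by blast
  qed
qed

text \<open>Used in both directions: connectivity of the graph makes the polytope full-dimensional,
  and the spanning property of a facet makes its subnetwork connected.\<close>

corollary span_arc_vectors_iff_connected:
  fixes H :: "'n::finite option pair_pre_digraph"
  assumes "pverts H = UNIV"
  shows "span (arc_vectors (parcs H)) = UNIV \<longleftrightarrow> Digraph_Component.connected (with_proj H)"
  using assms by (simp only: span_arc_vectors_iff connected_iff_potentials_constant)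

section \<open>Heights along walks\<close>

lemma awalk_with_proj_iff:
  "pre_digraph.awalk (with_proj H) u p v \<longleftrightarrow> u \<in> pverts H \<and> set p \<subseteq> parcs H \<and> pcas u p v"
  by (simp add: pre_digraph.awalk_def cas_with_proj_eq)

lemma pcas_unit_descent:
  fixes h :: "'a \<Rightarrow> real"
  assumes "pcas u p v" and "\<And>i j. (i, j) \<in> set p \<Longrightarrow> h i - h j = 1"
  shows "h u - h v = length p"
  using assms
proof (induction u p v rule: pcas.induct)
  case (2 u e es v)
  have "h (fst e) - h (snd e) = 1"
    using 2(3)[of "fst e" "snd e"] by simp
  moreover have "h (snd e) - h v = length es"
    using 2 by simp
  ultimately show ?case
    using 2(2) by simp
qed simp

lemma pcas_arc_ends_in_verts:
  assumes "pcas u p v" and "(i, j) \<in> set p"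
  shows "i \<in> set (pawalk_verts u p)" and "j \<in> set (pawalk_verts u p)"
proof -
  have hd: "w \<in> set (pawalk_verts w q)" if "pcas w q v" for w q
    using that by (cases q) auto
  show "i \<in> set (pawalk_verts u p)" "j \<in> set (pawalk_verts u p)"
    using assms by (induction p arbitrary: u) (auto dest: hd)
qed

lemma pcas_height_via_vertex:
  fixes h :: "'a \<Rightarrow> real"
  assumes "pcas x c y" and "\<forall>(i, j) \<in> set c. \<bar>h i - h j\<bar> \<le> 1"
    and "a \<in> set (pawalk_verts x c)"
  shows "\<bar>h x - h a\<bar> + \<bar>h a - h y\<bar> \<le> length c"
  using assms
proof (induction x c y arbitrary: a rule: pcas.induct)
  case (2 x e es y)
  have step: "\<bar>h x - h (snd e)\<bar> \<le> 1"
    using 2(2,3) by (auto simp: case_prod_beta)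
  \<comment> \<open>The extra instance \<open>b = snd e\<close> of the induction hypothesis handles
    the case that \<open>a\<close> is the first vertex \<open>x\<close>.\<close>
  have "snd e \<in> set (pawalk_verts (snd e) es)"
    using 2(2) by (cases es) auto
  then have IH: "\<bar>h (snd e) - h b\<bar> + \<bar>h b - h y\<bar> \<le> length es"
    if "b = snd e \<or> b \<in> set (pawalk_verts (snd e) es)" for b
    using 2(1)[of b] 2(2,3) that by auto
  show ?case
    using 2(2,4) step IH[of a] IH[of "snd e"] by auto
qed simp

text \<open>The disjuncts reflect the order in which the walk visits \<open>a\<close> and
  \<open>b\<close>. Once the walk stands at one of them, the bound through a single vertex finishes
  the argument.\<close>

lemma pcas_height_via_two_vertices:
  fixes h :: "'a \<Rightarrow> real"
  assumes "pcas x c y" and "\<forall>(i, j) \<in> set c. \<bar>h i - h j\<bar> \<le> 1"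
    and "a \<in> set (pawalk_verts x c)" and "b \<in> set (pawalk_verts x c)"
  shows "\<bar>h x - h a\<bar> + \<bar>h a - h b\<bar> + \<bar>h b - h y\<bar> \<le> length c
    \<or> \<bar>h x - h b\<bar> + \<bar>h b - h a\<bar> + \<bar>h a - h y\<bar> \<le> length c"
  using assms
proof (induction x c y rule: pcas.induct)
  case (2 x e es y)
  show ?case
  proof (cases "a = x \<or> b = x")
    case True
    then show ?thesis
      using pcas_height_via_vertex[OF 2(2,3,4)] pcas_height_via_vertex[OF 2(2,3,5)] by auto
  next
    case False
    have step: "\<bar>h x - h (snd e)\<bar> \<le> 1"
      using 2(2,3) by (auto simp: case_prod_beta)
    have IH: "\<bar>h (snd e) - h a\<bar> + \<bar>h a - h b\<bar> + \<bar>h b - h y\<bar> \<le> length es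
      \<or> \<bar>h (snd e) - h b\<bar> + \<bar>h b - h a\<bar> + \<bar>h a - h y\<bar> \<le> length es"
      using 2 False by simp
    have "\<bar>h x - h w\<bar> \<le> 1 + \<bar>h (snd e) - h w\<bar>" for w
      using step by linarith
    from IH this[of a] this[of b] show ?thesis
      by auto
  qed
qed simp

text \<open>With equal end points, the first and last summands of the previous bound are together at
  least \<open>\<bar>h a - h b\<bar>\<close> by the triangle inequality: this is the way back
  through \<open>w\<close>.\<close>

lemma closed_walk_height_bound:
  fixes h :: "'a \<Rightarrow> real"
  assumes "pcas w c w" and "\<forall>(i, j) \<in> set c. \<bar>h i - h j\<bar> \<le> 1"
    and "a \<in> set (pawalk_verts w c)" and "b \<in> set (pawalk_verts w c)"
  shows "2 * \<bar>h a - h b\<bar> \<le> length c"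
  using pcas_height_via_two_vertices[OF assms] by (smt (verit))

text \<open>The converse is included because the path may run against the chosen orientation of the
  cycle. An empty path could sit at a node off the cycle.\<close>

lemma pcas_ends_on_walk:
  assumes "pcas w c w'" and "pcas u p v" and "p \<noteq> []" and "set p \<subseteq> set c \<union> (set c)\<inverse>"
  shows "u \<in> set (pawalk_verts w c)" and "v \<in> set (pawalk_verts w c)"
proof -
  have ends: "i \<in> set (pawalk_verts w c) \<and> j \<in> set (pawalk_verts w c)" if "(i, j) \<in> set p" for i j
    using that assms(4) pcas_arc_ends_in_verts[OF assms(1)] by blast
  have "\<exists>j. (u, j) \<in> set p"
    using assms(2,3) by (cases p) (auto intro: prod.collapse)
  moreover have "\<exists>i. (i, v) \<in> set p"
    using assms(2,3)
  proof (induction u p v rule: pcas.induct)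
    case (2 u e es v)
    then show ?case
      by (cases es; cases e) auto
  qed simp
  ultimately show "u \<in> set (pawalk_verts w c)" "v \<in> set (pawalk_verts w c)"
    using ends by blast+
qed

section \<open>Facets of the adjacency polytope\<close>

lemma uminus_arc_vectors: "uminus ` arc_vectors A = arc_vectors (A\<inverse>)"
  by (force simp: arc_vectors_def)

lemma uminus_adjacency_polytope:
  assumes "(parcs G)\<inverse> = parcs G"
  shows "uminus ` adjacency_polytope G = adjacency_polytope G"
proof -
  have "uminus ` (convex hull arc_vectors (parcs G)) = convex hull (uminus ` arc_vectors (parcs G))"
    by (rule convex_hull_linear_image) (simp add: linear_uminus)
  then show ?thesis
    by (simp add: adjacency_polytope_eq uminus_arc_vectors assms)
qed

lemma is_facet_uminus:
  fixes F :: "(real ^ 'n::finite) set"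
  assumes "(parcs G)\<inverse> = parcs G" and "is_facet G F"
  shows "is_facet G (uminus ` F)"
proof -
  have "linear (uminus :: real ^ 'n \<Rightarrow> _)" "inj (uminus :: real ^ 'n \<Rightarrow> _)"
    by (simp_all add: linear_uminus)
  then show ?thesis
    using assms(2) face_of_linear_image[of uminus F "adjacency_polytope G"]
    by (simp add: is_facet_def uminus_adjacency_polytope[OF assms(1)])
qed

lemma facet_arcs_uminus: "facet_arcs (uminus ` F) = (facet_arcs F)\<inverse>"
proof -
  have "x \<in> uminus ` F \<longleftrightarrow> - x \<in> F" for x
    by force
  then show ?thesis
    by (auto simp: facet_arcs_def)
qed

lemma facet_nodes_conv_arcs: "facet_nodes F = {i. \<exists>j. (i, j) \<in> facet_arcs F \<or> (j, i) \<in> facet_arcs F}"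
  by (simp add: facet_nodes_def facet_arcs_def)

lemma transpose_facet_subnetwork:
  "transpose_digraph (facet_subnetwork F) = facet_subnetwork (uminus ` F)"
  by (auto simp: transpose_digraph_def facet_subnetwork_def facet_nodes_conv_arcs facet_arcs_uminus)

text \<open>Central symmetry puts the origin into the polytope and spanning makes it
  full-dimensional, so a facet is a proper face. Its hyperplane cannot pass through the origin, and
  rescaling brings the right-hand side to 1.\<close>

lemma facet_supporting_hyperplane:
  assumes sym: "(parcs G)\<inverse> = parcs G" and span: "span (arc_vectors (parcs G)) = UNIV"
    and facet: "is_facet G F"
  obtains a where "\<And>x. x \<in> adjacency_polytope G \<Longrightarrow> a \<bullet> x \<le> 1" and "\<And>x. x \<in> F \<Longrightarrow> a \<bullet> x = 1"
proof -
  let ?P = "adjacency_polytope G"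
  have face: "F face_of ?P" and dim: "aff_dim F = int CARD('a) - 1"
    using facet by (simp_all add: is_facet_def)
  have minus: "- x \<in> ?P" if "x \<in> ?P" for x
    using that uminus_adjacency_polytope[OF sym] by blast
  have "?P \<noteq> {}"
  proof
    assume "?P = {}"
    then have "arc_vectors (parcs G) = {}"
      by (simp add: adjacency_polytope_eq)
    then show False
      using span by (metis dim_UNIV dim_empty dim_span DIM_positive less_irrefl)
  qed
  then obtain x where "x \<in> ?P"
    by blast
  then have "(1/2) *\<^sub>R x + (1/2) *\<^sub>R (- x) \<in> ?P"
    by (intro convexD minus) (auto simp: adjacency_polytope_def)
  then have zero: "0 \<in> ?P"
    by simp
  have spanP: "span ?P = UNIV"
    using span span_mono[OF hull_subset[of "arc_vectors (parcs G)" convex]]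
    by (auto simp: adjacency_polytope_eq)
  then have "aff_dim ?P = CARD('a)"
    using aff_dim_zero[OF hull_inc[OF zero]] dim_eq_full[of ?P] by simp
  then have "F \<noteq> ?P"
    using dim by auto
  moreover have "F \<noteq> {}"
    using dim by auto
  \<comment> \<open>Every face of a polyhedron is exposed, that is, cut out by a supporting
    hyperplane.\<close>
  moreover have "F exposed_face_of ?P"
    using face by (simp add: adjacency_polytope_eq arc_vectors_def
        exposed_face_of_polyhedron polyhedron_convex_hull)
  ultimately obtain a b where ab: "a \<noteq> 0" "\<And>x. x \<in> ?P \<Longrightarrow> a \<bullet> x \<le> b" "F = ?P \<inter> {x. a \<bullet> x = b}"
    unfolding exposed_face_of by blast
  \<comment> \<open>If \<open>b = 0\<close>, then the inequality at \<open>x\<close> and at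
    \<open>- x\<close> makes \<open>a\<close> orthogonal to the whole polytope, which spans.\<close>
  have "b \<noteq> 0"
  proof
    assume "b = 0"
    then have "orthogonal a x" if "x \<in> ?P" for x
      using ab(2)[OF that] ab(2)[OF minus[OF that]] by (simp add: orthogonal_def)
    then have "orthogonal a a"
      using orthogonal_to_span spanP by blast
    then show False
      using ab(1) by (simp add: orthogonal_self)
  qed
  then have "b > 0"
    using ab(2)[OF zero] by simp
  show thesis
    by (rule that[of "a /\<^sub>R b"]) (use \<open>b > 0\<close> ab in \<open>auto simp: field_simps\<close>)
qed

text \<open>The affine hull of \<open>F\<close> misses the origin, so adjoining 0 raises the affine
  dimension by one, to that of the whole space.\<close>

lemma span_facet:
  assumes dim: "aff_dim F = int CARD('n) - 1" and F: "\<And>x. x \<in> F \<Longrightarrow> a \<bullet> x = 1"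
  shows "span F = (UNIV :: (real ^ 'n::finite) set)"
proof -
  have "affine hull F \<subseteq> {x. a \<bullet> x = 1}"
    using F by (intro hull_minimal) (auto simp: affine_hyperplane)
  then have "0 \<notin> affine hull F"
    by auto
  then have "aff_dim (insert 0 F) = CARD('n)"
    using dim by (simp add: aff_dim_insert)
  moreover have "aff_dim (insert 0 F) = dim (insert 0 F)"
    by (rule aff_dim_zero) (simp add: hull_inc)
  ultimately have "dim (insert 0 F) = DIM(real ^ 'n)"
    by simp
  then show ?thesis
    by (simp only: dim_eq_full span_insert_0)
qed

text \<open>A face of the convex hull of a compact set is the hull of some of the generators. Those
  generators are arc vectors lying in \<open>F\<close>, so they already span whatever
  \<open>F\<close> spans.\<close>

lemma span_facet_arcs:
  assumes "F face_of adjacency_polytope G" and "span F = UNIV"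
  shows "span (arc_vectors (facet_arcs F)) = UNIV"
proof -
  have "compact (arc_vectors (parcs G))"
    by (simp add: arc_vectors_def finite_imp_compact)
  then obtain S where S: "S \<subseteq> arc_vectors (parcs G)" "F = convex hull S"
    using assms(1) face_of_convex_hull_subset unfolding adjacency_polytope_eq by blast
  have "S \<subseteq> arc_vectors (facet_arcs F)"
    using S(1) hull_subset[of S convex] unfolding S(2)[symmetric]
    by (force simp: arc_vectors_def facet_arcs_def)
  then have "F \<subseteq> span (arc_vectors (facet_arcs F))"
    unfolding S(2) by (meson convex_hull_subset_span order_trans span_mono)
  then show ?thesis
    using assms(2) span_minimal[OF _ subspace_span] by blast
qed

theorem theorem1:
  fixes G :: "'n::finite option pair_pre_digraph"
    and F :: "(real ^ 'n) set"
  assumes "pair_graph G"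
    and "pverts G = UNIV"
    and "Digraph_Component.connected (with_proj G)"
    and "is_facet G F"
  shows "(\<not> (\<exists>c. pre_digraph.cycle (with_proj (facet_subnetwork F)) c))
    \<and> (pverts (facet_subnetwork F) = UNIV)
    \<and> (Digraph_Component.connected (with_proj (facet_subnetwork F)))
    \<and> (\<forall>u v p q. pre_digraph.apath (with_proj (facet_subnetwork F)) u p v
           \<and> pre_digraph.apath (with_proj (facet_subnetwork F)) u q v
           \<longrightarrow> length p = length q)
    \<and> (\<forall>u v p c. pre_digraph.apath (with_proj (facet_subnetwork F)) u p v
           \<and> undirected_cycle G c \<and> set p \<subseteq> set c \<union> (set c)\<inverse>
           \<longrightarrow> real (length p) \<le> real (length c) / 2)
    \<and> (is_facet G (uminus ` F)
           \<and> transpose_digraph (facet_subnetwork F) = facet_subnetwork (uminus ` F))"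
proof -
  interpret G: pair_graph G by fact
  have sym: "(parcs G)\<inverse> = parcs G"
    using G.arcs_symmetric by auto
  have spanG: "span (arc_vectors (parcs G)) = UNIV"
    using assms(2,3) by (simp add: span_arc_vectors_iff_connected)
  obtain a where a: "\<And>x. x \<in> adjacency_polytope G \<Longrightarrow> a \<bullet> x \<le> 1" "\<And>x. x \<in> F \<Longrightarrow> a \<bullet> x = 1"
    using facet_supporting_hyperplane[OF sym spanG assms(4)] by blast
  define h where "h v = a \<bullet> node_vec v" for v
  have le: "h i - h j \<le> 1" if "(i, j) \<in> parcs G" for i j
  proof -
    have "node_vec i - node_vec j \<in> adjacency_polytope G"
      using that unfolding adjacency_polytope_def by (intro hull_inc) auto
    then show ?thesis
      using a(1) by (simp add: h_def inner_diff_right[symmetric])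
  qed
  have edge: "\<bar>h i - h j\<bar> \<le> 1" if "(i, j) \<in> parcs G" for i j
    using le[OF that] le[OF G.arcs_symmetric[OF that]] by linarith
  have arc: "h i - h j = 1" if "(i, j) \<in> facet_arcs F" for i j
    using that a(2) by (simp add: facet_arcs_def h_def inner_diff_right[symmetric])
  let ?N = "facet_subnetwork F"
  have parcs: "parcs ?N = facet_arcs F"
    by (simp add: facet_subnetwork_def)
  have len: "h u - h v = length p" if "pre_digraph.awalk (with_proj ?N) u p v" for u p v
    using that arc by (intro pcas_unit_descent) (auto simp: awalk_with_proj_iff parcs)
  have apath_awalk: "pre_digraph.awalk (with_proj ?N) u p v"
    if "pre_digraph.apath (with_proj ?N) u p v" for u p v
    using that by (simp add: pre_digraph.apath_def)
  have spanF: "span (arc_vectors (facet_arcs F)) = UNIV"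
    using assms(4) span_facet[OF _ a(2)] by (intro span_facet_arcs) (auto simp: is_facet_def)
  \<comment> \<open>A cycle is a nonempty closed walk, but the height difference of its equal end
    points forces length 0.\<close>
  have acyclic: "\<not> (\<exists>c. pre_digraph.cycle (with_proj ?N) c)"
    using len by (fastforce simp: pre_digraph.cycle_def)
  have nodes: "pverts ?N = UNIV"
  proof -
    have "v \<in> facet_nodes F" for v
    proof (rule ccontr)
      assume v: "v \<notin> facet_nodes F"
      obtain w where "w \<noteq> v"
        by (metis option.distinct(1))
      \<comment> \<open>No arc of the subnetwork touches \<open>v\<close>, so the indicator of
        \<open>v\<close> is constant along arcs although it separates \<open>v\<close> from
        \<open>w\<close>.\<close>
      define g :: "'n option \<Rightarrow> real" where "g i = of_bool (i = v)" for i
      have "\<forall>(i, j) \<in> facet_arcs F. g i = g j"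
        using v by (auto simp: facet_nodes_conv_arcs g_def)
      then have "g v = g w"
        using spanF unfolding span_arc_vectors_iff by blast
      then show False
        using \<open>w \<noteq> v\<close> by (simp add: g_def)
    qed
    then show ?thesis
      by (auto simp: facet_subnetwork_def)
  qed
  have connected: "Digraph_Component.connected (with_proj ?N)"
    using spanF by (simp add: span_arc_vectors_iff_connected[OF nodes, symmetric] parcs)
  have same_length: "length p = length q"
    if "pre_digraph.apath (with_proj ?N) u p v" "pre_digraph.apath (with_proj ?N) u q v" for u v p q
    using that[THEN apath_awalk, THEN len] by simp
  have half: "real (length p) \<le> real (length c) / 2"
    if p: "pre_digraph.apath (with_proj ?N) u p v" and c: "undirected_cycle G c"
      and sub: "set p \<subseteq> set c \<union> (set c)\<inverse>" for u v p c
  proof (cases "p = []")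
    case False
    obtain w where w: "pcas w c w" "set c \<subseteq> parcs G"
      using c by (auto simp: undirected_cycle_def pre_digraph.cycle_def awalk_with_proj_iff)
    have "pcas u p v"
      using apath_awalk[OF p] by (simp add: awalk_with_proj_iff)
    \<comment> \<open>Arcs of the cycle change the height by at most 1, while the path, all of whose
      arcs descend by exactly 1, realises its full length as a height difference between two nodes
      of the cycle.\<close>
    then have "2 * \<bar>h u - h v\<bar> \<le> length c"
      using w edge False sub by (intro closed_walk_height_bound[OF w(1)] pcas_ends_on_walk) auto
    then show ?thesis
      using len[OF apath_awalk[OF p]] by simp
  qed simp
  show ?thesis
    using acyclic nodes connected same_length half is_facet_uminus[OF sym assms(4)]
      transpose_facet_subnetwork[of F]
    by blast
qed

end
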